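(* Let $a\ge 2$, $n=2^a$, and let $\mathcal{S}$ be a normalized unitary-weight single-symbol decodable STBC of maximal rate, i.e. with $k=2a$ complex symbols and weight matrices $A_{1I}=I_n, A_{1Q}, A_{iI}, A_{iQ}$ ($2\le i\le 2a$). Then $$A_{1Q}=A_{1Q}^H\ (\text{equivalently } A_{1Q}^2=I_n),\qquad A_{iI}A_{1Q}=A_{1Q}A_{iI},\qquad A_{iQ}=\pm A_{iI}A_{1Q}$$ for $i=2,3,\dots,2a$.
   Context: A linear square STBC with $k$ complex symbols is given by $2k$ weight matrices $A_{iI},A_{iQ}\in\mathbb{C}^{n\times n}$ ($1\le i\le k$), linearly independent over $\mathbb{R}$, with codewords $S=\sum_{i=1}^k(x_{iI}A_{iI}+x_{iQ}A_{iQ})$. It is a unitary-weight single-symbol decodable (SSD) code if: (i) $A_{iI}^HA_{iI}=A_{iQ}^HA_{iQ}=I_n$ for all $i$; (ii) for all $1\le i\ne j\le k$: $A_{iI}^HA_{jQ}+A_{jQ}^HA_{iI}=O_n$, $A_{iI}^HA_{jI}+A_{jI}^HA_{iI}=O_n$, $A_{iQ}^HA_{jQ}+A_{jQ}^HA_{iQ}=O_n$; and (iii) it is not the case that $A_{iI}^HA_{iQ}+A_{iQ}^HA_{iI}=O_n$ for all $i$. It is normalized if $A_{1I}=I_n$. For $n=2^a$ the rate of such a code is at most $2a/2^a$, so maximal rate means $k=2a$. *)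

theory Defs
  imports "Jordan_Normal_Form.Schur_Decomposition"
begin

definition real_lin_indep_weights ::
  "nat \<Rightarrow> nat \<Rightarrow> (nat \<Rightarrow> complex mat) \<Rightarrow> (nat \<Rightarrow> complex mat) \<Rightarrow> bool" where
  "real_lin_indep_weights n k AI AQ \<longleftrightarrow>
     (\<forall>c d :: nat \<Rightarrow> real.
        (\<forall>r<n. \<forall>s<n. (\<Sum>i\<in>{1..k}. complex_of_real (c i) * AI i $$ (r,s)
                                     + complex_of_real (d i) * AQ i $$ (r,s)) = 0)
        \<longrightarrow> (\<forall>i\<in>{1..k}. c i = 0 \<and> d i = 0))"

definition unitary_weight_SSD ::
  "nat \<Rightarrow> nat \<Rightarrow> (nat \<Rightarrow> complex mat) \<Rightarrow> (nat \<Rightarrow> complex mat) \<Rightarrow> bool" where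
  "unitary_weight_SSD n k AI AQ \<longleftrightarrow>
     (\<forall>i\<in>{1..k}. AI i \<in> carrier_mat n n \<and> AQ i \<in> carrier_mat n n) \<and>
     real_lin_indep_weights n k AI AQ \<and>
     (\<forall>i\<in>{1..k}. mat_adjoint (AI i) * AI i = 1\<^sub>m n \<and> mat_adjoint (AQ i) * AQ i = 1\<^sub>m n) \<and>
     (\<forall>i\<in>{1..k}. \<forall>j\<in>{1..k}. i \<noteq> j \<longrightarrow>
        mat_adjoint (AI i) * AQ j + mat_adjoint (AQ j) * AI i = 0\<^sub>m n n \<and>
        mat_adjoint (AI i) * AI j + mat_adjoint (AI j) * AI i = 0\<^sub>m n n \<and>
        mat_adjoint (AQ i) * AQ j + mat_adjoint (AQ j) * AQ i = 0\<^sub>m n n) \<and>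
     \<not> (\<forall>i\<in>{1..k}. mat_adjoint (AI i) * AQ i + mat_adjoint (AQ i) * AI i = 0\<^sub>m n n)"

definition normalized_STBC :: "nat \<Rightarrow> (nat \<Rightarrow> complex mat) \<Rightarrow> bool" where
  "normalized_STBC n AI \<longleftrightarrow> AI 1 = 1\<^sub>m n"

end

theory Submission
  imports Defs
begin

text \<open>
  The weights \<open>AI i\<close>, \<open>i \<ge> 2\<close>, are \<open>2a - 1\<close> anticommuting skew-Hermitian unitaries, and \<open>AQ i\<close>
  anticommutes with every \<open>AI j\<close>, \<open>j \<noteq> i\<close>. Halving the identity once for each pair among \<open>2a - 2\<close> of
  the \<open>AI i\<close> leaves a projection of trace 2, on whose range every matrix that commutes or
  anticommutes with these generators acts faithfully.

  Let \<open>F\<close> be the difference of \<open>AQ 1\<close> and its adjoint; it anticommutes with all weights. If \<open>F\<close> were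
  nonzero, only scalars would commute with \<open>F\<close> and all \<open>AI i\<close>. Then \<open>AI i AQ i + AQ i AI i\<close> is a
  real scalar, so that \<open>Y i = AQ i - r i AI i\<close> anticommutes with \<open>F\<close> and all \<open>AI j\<close> for some real
  \<open>r i\<close>. As \<open>Y 2\<close> and \<open>Y 3\<close> also anticommute with each other while \<open>Y 2 Y 3\<close> and the square of
  \<open>Y 2\<close> are scalars, one of them vanishes, against linear independence. Hence \<open>AQ 1\<close> is a Hermitian
  involution commuting with all weights. It splits a two-dimensional range as above into two lines,
  so the involution \<open>AI i AQ i\<close> lies in the span of the identity and \<open>AQ 1\<close>, and by linear
  independence it is \<open>AQ 1\<close> up to sign.
\<close>

subsection \<open>Adjoint and trace\<close>

lemma dim_mat_adjoint [simp]:
  "dim_row (mat_adjoint A) = dim_col A" "dim_col (mat_adjoint A) = dim_row A"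
  by (simp_all add: mat_adjoint_def)

lemma mat_adjoint_carrier [simp]:
  "A \<in> carrier_mat m k \<Longrightarrow> mat_adjoint A \<in> carrier_mat k m"
  by auto

lemma index_mat_adjoint [simp]:
  "i < dim_col A \<Longrightarrow> j < dim_row A \<Longrightarrow> mat_adjoint A $$ (i, j) = conjugate (A $$ (j, i))"
  by (simp add: mat_adjoint_def mat_of_rows_def)

lemma mat_adjoint_one [simp]: "mat_adjoint (1\<^sub>m m) = (1\<^sub>m m :: complex mat)"
  by (intro eq_matI) auto

lemma mat_adjoint_uminus [simp]: "mat_adjoint (- A) = - mat_adjoint A"
  by (intro eq_matI) (auto simp: conjugate_neg)

lemma mat_adjoint_smult [simp]: "mat_adjoint (a \<cdot>\<^sub>m A) = conjugate a \<cdot>\<^sub>m mat_adjoint A"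
  by (intro eq_matI) (auto simp: conjugate_dist_mul)

lemma mat_adjoint_add:
  assumes "A \<in> carrier_mat m k" "B \<in> carrier_mat m k"
  shows "mat_adjoint (A + B) = mat_adjoint A + mat_adjoint B"
  using assms by (intro eq_matI) (auto simp: conjugate_dist_add)

lemma mat_adjoint_diff:
  assumes "A \<in> carrier_mat m k" "B \<in> carrier_mat m k"
  shows "mat_adjoint (A - B) = mat_adjoint A - mat_adjoint B"
  using assms mat_adjoint_add[of A m k "- B"] by (simp add: minus_add_uminus_mat[of _ m k]
      minus_add_uminus_mat[of _ k m])

lemma mat_adjoint_mult:
  assumes "A \<in> carrier_mat m k" "B \<in> carrier_mat k p"
  shows "mat_adjoint (A * B) = mat_adjoint B * mat_adjoint A"
  using assms
  by (intro eq_matI) (auto simp: scalar_prod_def sum_conjugate conjugate_dist_mul mult.commute)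

definition trace :: "'a :: comm_monoid_add mat \<Rightarrow> 'a" where
  "trace A = (\<Sum>i<dim_row A. A $$ (i, i))"

lemma trace_one [simp]: "trace (1\<^sub>m m :: 'a :: semiring_1 mat) = of_nat m"
  by (simp add: trace_def)

lemma trace_zero [simp]: "trace (0\<^sub>m m m) = 0"
  by (simp add: trace_def)

lemma trace_uminus:
  fixes A :: "'a :: ab_group_add mat"
  assumes "A \<in> carrier_mat m m"
  shows "trace (- A) = - trace A"
  using assms by (auto simp: trace_def sum_negf)

lemma trace_smult:
  fixes A :: "'a :: semiring_0 mat"
  assumes "A \<in> carrier_mat m m"
  shows "trace (a \<cdot>\<^sub>m A) = a * trace A"
  using assms by (auto simp: trace_def sum_distrib_left)

lemma trace_diff:
  fixes A :: "'a :: ab_group_add mat"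
  assumes "A \<in> carrier_mat m m" "B \<in> carrier_mat m m"
  shows "trace (A - B) = trace A - trace B"
  using assms by (auto simp: trace_def sum_subtractf)

lemma trace_mult:
  fixes A :: "'a :: semiring_0 mat"
  assumes "A \<in> carrier_mat m k" "B \<in> carrier_mat k m"
  shows "trace (A * B) = (\<Sum>i<m. \<Sum>j<k. A $$ (i, j) * B $$ (j, i))"
  using assms by (auto simp: trace_def scalar_prod_def atLeast0LessThan)

lemma trace_mult_commute:
  fixes A :: "'a :: comm_semiring_0 mat"
  assumes "A \<in> carrier_mat m k" "B \<in> carrier_mat k m"
  shows "trace (A * B) = trace (B * A)"
  unfolding trace_mult[OF assms] trace_mult[OF assms(2,1)]
  by (subst sum.swap) (simp add: mult.commute)

lemma trace_adjoint_mult: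
  assumes "A \<in> carrier_mat m k"
  shows "trace (mat_adjoint A * A) = (\<Sum>i<k. \<Sum>j<m. A $$ (j, i) * conjugate (A $$ (j, i)))"
  using assms trace_mult[of "mat_adjoint A" k m A]
  by (auto intro!: sum.cong simp: mult.commute)

lemma trace_adjoint_mult_nonneg:
  fixes A :: "'a :: conjugatable_ordered_field mat"
  assumes "A \<in> carrier_mat m k"
  shows "0 \<le> trace (mat_adjoint A * A)"
  unfolding trace_adjoint_mult[OF assms] by (intro sum_nonneg conjugate_square_positive)

lemma trace_adjoint_mult_eq_0_iff:
  fixes A :: "'a :: conjugatable_ordered_field mat"
  assumes "A \<in> carrier_mat m k"
  shows "trace (mat_adjoint A * A) = 0 \<longleftrightarrow> A = 0\<^sub>m m k"
proof
  assume "trace (mat_adjoint A * A) = 0"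
  then have "\<forall>i<k. \<forall>j<m. A $$ (j, i) = 0"
    by (simp add: trace_adjoint_mult[OF assms] sum_nonneg_eq_0_iff sum_nonneg
        conjugate_square_positive)
  then show "A = 0\<^sub>m m k" using assms by (intro eq_matI) auto
qed simp

subsection \<open>Linear identities between matrices\<close>

lemma smult_smult_mat [simp]: "a \<cdot>\<^sub>m (b \<cdot>\<^sub>m A) = (a * b :: 'a :: semigroup_mult) \<cdot>\<^sub>m A"
  by (intro eq_matI) (auto simp: mult.assoc)

lemma one_smult_mat [simp]: "(1 :: 'a :: monoid_mult) \<cdot>\<^sub>m A = A"
  by (intro eq_matI) auto

lemma smult_uminus_mat [simp]: "a \<cdot>\<^sub>m (- A) = - ((a :: 'a :: ring) \<cdot>\<^sub>m A)"
  by (intro eq_matI) auto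

lemma uminus_smult_mat [simp]: "(- a) \<cdot>\<^sub>m A = - ((a :: 'a :: ring) \<cdot>\<^sub>m A)"
  by (intro eq_matI) auto

lemma zero_smult_mat [simp]: "(0 :: 'a :: mult_zero) \<cdot>\<^sub>m A = 0\<^sub>m (dim_row A) (dim_col A)"
  by (intro eq_matI) auto

lemma smult_eq_zero_mat_iff [simp]:
  fixes A :: "'a :: semiring_no_zero_divisors mat"
  assumes "A \<in> carrier_mat m k"
  shows "a \<cdot>\<^sub>m A = 0\<^sub>m m k \<longleftrightarrow> a = 0 \<or> A = 0\<^sub>m m k"
  using assms by (auto simp: mat_eq_iff)

lemma smult_one_mat_cancel:
  fixes a b :: "'a :: semiring_1"
  assumes "m > 0"
  shows "a \<cdot>\<^sub>m 1\<^sub>m m = b \<cdot>\<^sub>m 1\<^sub>m m \<longleftrightarrow> a = b"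
proof
  assume "a \<cdot>\<^sub>m 1\<^sub>m m = b \<cdot>\<^sub>m 1\<^sub>m m"
  from arg_cong[OF this, of "\<lambda>A. A $$ (0, 0)"] show "a = b" using assms by simp
qed simp

lemma uminus_eq_zero_mat_iff [simp]: "- A = 0\<^sub>m m k \<longleftrightarrow> A = (0\<^sub>m m k :: 'a :: group_add mat)"
  by (auto simp: mat_eq_iff)

lemma diff_eq_zero_mat_iff:
  fixes A :: "'a :: group_add mat"
  assumes "A \<in> carrier_mat m k" "B \<in> carrier_mat m k"
  shows "A - B = 0\<^sub>m m k \<longleftrightarrow> A = B"
  using assms by (auto simp: mat_eq_iff)

lemma add_eq_zero_mat_iff:
  fixes A :: "'a :: group_add mat"
  assumes "A \<in> carrier_mat m k" "B \<in> carrier_mat m k"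
  shows "A + B = 0\<^sub>m m k \<longleftrightarrow> A = - B"
  using assms by (auto simp: mat_eq_iff eq_neg_iff_add_eq_0)

lemma eq_uminus_mat_iff:
  fixes A :: "'a :: {idom, ring_char_0} mat"
  assumes "A \<in> carrier_mat m k"
  shows "A = - A \<longleftrightarrow> A = 0\<^sub>m m k"
  using assms by (auto simp: mat_eq_iff eq_neg_iff_add_eq_0 simp flip: mult_2)

lemma uminus_diff_mat:
  fixes A :: "'a :: ab_group_add mat"
  assumes "A \<in> carrier_mat m k" "B \<in> carrier_mat m k"
  shows "- (A - B) = B - A"
  using assms by (auto simp: mat_eq_iff)

abbreviation (input) commuting :: "'a :: times \<Rightarrow> 'a \<Rightarrow> bool" where
  "commuting A B \<equiv> A * B = B * A"

abbreviation (input) anticommuting :: "'a :: {times, uminus} \<Rightarrow> 'a \<Rightarrow> bool" where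
  "anticommuting A B \<equiv> A * B = - (B * A)"

locale square_mats =
  fixes n :: nat
begin

abbreviation M :: "complex mat set" where "M \<equiv> carrier_mat n n"
abbreviation I :: "complex mat" where "I \<equiv> 1\<^sub>m n"

lemmas square_dims [simp] = carrier_matD[of _ n n]
lemmas square_carrier [simp] = mult_carrier_mat[of _ n n _ n] minus_carrier_mat[of _ n n]

lemmas square_adjoint [simp] =
  mat_adjoint_add[of _ n n] mat_adjoint_diff[of _ n n] mat_adjoint_mult[of _ n n _ n]
lemmas square_trace [simp] = trace_uminus[of _ n] trace_smult[of _ n] trace_diff[of _ n]
lemmas square_mult [simp] = assoc_mult_mat[of _ n n _ n _ n]
  mult_smult_assoc_mat[of _ n n _ n] mult_smult_distrib[of _ n n _ n]
lemmas square_distribs = add_mult_distrib_mat[of _ n n _ _ n] mult_add_distrib_mat[of _ n n _ n]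
  minus_mult_distrib_mat[of _ n n _ _ n] mult_minus_distrib_mat[of _ n n _ n]

lemma mult_eq_assoc:
  assumes "A * B = C" "A \<in> M" "B \<in> M" "X \<in> M"
  shows "A * (B * X) = C * X"
  using assms(1) assoc_mult_mat[OF assms(2-4)] by simp

lemma commuting_mult_right:
  assumes "X \<in> M" "A \<in> M" "B \<in> M" "commuting X A" "commuting X B"
  shows "commuting X (A * B)"
  using assms mult_eq_assoc[OF assms(4)] by simp

lemma anticommuting_mult_right:
  assumes "X \<in> M" "A \<in> M" "B \<in> M" "anticommuting X A" "anticommuting X B"
  shows "commuting X (A * B)"
  using assms mult_eq_assoc[OF assms(4)] by simp

lemma anticommuting_diff_smult:
  assumes "A \<in> M" "B \<in> M" "X \<in> M" "anticommuting A X" "anticommuting B X"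
  shows "anticommuting (A - c \<cdot>\<^sub>m B) X"
  using assms by (auto simp: square_distribs intro!: eq_matI)

subsection \<open>Orthogonal projections\<close>

definition projection :: "complex mat \<Rightarrow> bool" where
  "projection P \<longleftrightarrow> P \<in> M \<and> mat_adjoint P = P \<and> P * P = P"

lemma projectionD:
  assumes "projection P"
  shows "P \<in> M" "mat_adjoint P = P" "P * P = P"
  using assms by (simp_all add: projection_def)

lemma projection_one: "projection I"
  by (simp add: projection_def)

lemma projection_trace_nonneg: "projection P \<Longrightarrow> 0 \<le> trace P"
  using trace_adjoint_mult_nonneg[of P n n] by (simp add: projection_def)

lemma projection_trace_eq_0_iff: "projection P \<Longrightarrow> trace P = 0 \<longleftrightarrow> P = 0\<^sub>m n n"
  using trace_adjoint_mult_eq_0_iff[of P n n] by (simp add: projection_def)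

lemma projection_diff:
  assumes "projection P" "projection R" "P * R = R" "R * P = R"
  shows "projection (P - R)"
proof -
  note [simp] = projectionD[OF assms(1)] projectionD[OF assms(2)] assms(3,4)
  have "(P - R) * (P - R) = P - R - (R - R)" by (simp add: square_distribs)
  also have "\<dots> = P - R" using projectionD(1)[OF assms(1)] projectionD(1)[OF assms(2)] by auto
  finally show ?thesis by (simp add: projection_def)
qed

definition diag_unit :: "nat \<Rightarrow> complex mat" where
  "diag_unit c = mat n n (\<lambda>(i, j). if i = c \<and> j = c then 1 else 0)"

lemma diag_unit_carrier [simp]: "diag_unit c \<in> M"
  by (simp add: diag_unit_def)

lemma mat_adjoint_diag_unit [simp]: "mat_adjoint (diag_unit c) = diag_unit c"
  by (intro eq_matI) (auto simp: diag_unit_def)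

lemma diag_unit_sandwich:
  assumes "A \<in> M" "c < n"
  shows "diag_unit c * (A * diag_unit c) = A $$ (c, c) \<cdot>\<^sub>m diag_unit c"
  using assms
  by (intro eq_matI) (auto simp: diag_unit_def scalar_prod_def if_distrib[of "\<lambda>x. x * _"]
      if_distrib[of "\<lambda>x. _ * x"] cong: if_cong)

lemma trace_diag_unit_mult:
  assumes "A \<in> M" "c < n"
  shows "trace (diag_unit c * A) = A $$ (c, c)"
proof -
  have "trace (diag_unit c * A) = (\<Sum>i<n. if i = c then A $$ (c, c) else 0)"
    using assms unfolding trace_mult[OF diag_unit_carrier assms(1)]
    by (intro sum.cong) (auto simp: diag_unit_def if_distrib[of "\<lambda>x. x * _"] cong: if_cong)
  then show ?thesis using assms by simp
qed

lemma rank_one_subprojection: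
  assumes P: "projection P" and nz: "P \<noteq> 0\<^sub>m n n"
  obtains R where "projection R" "trace R = 1" "P * R = R" "R * P = R"
    "\<And>X. X \<in> M \<Longrightarrow> \<exists>c. R * (X * R) = c \<cdot>\<^sub>m R"
proof -
  note [simp] = projectionD[OF P] mult_eq_assoc[OF projectionD(3)[OF P]]
  have "trace P \<noteq> 0" using projection_trace_eq_0_iff[OF P] nz by blast
  then obtain c where c: "c < n" "P $$ (c, c) \<noteq> 0"
    unfolding trace_def using projectionD(1)[OF P]
    by (auto dest: sum.not_neutral_contains_not_neutral)
  define p where "p = P $$ (c, c)"
  define E where "E = diag_unit c"
  have p: "p \<noteq> 0" using c by (simp add: p_def)
  have "cnj p = mat_adjoint P $$ (c, c)"
    using c carrier_matD[OF projectionD(1)[OF P]] by (subst index_mat_adjoint) (auto simp: p_def)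
  then have [simp]: "cnj p = p" by (simp add: p_def)
  have E [simp]: "E \<in> M" "mat_adjoint E = E" by (simp_all add: E_def)
  have EXE: "E * (X * (E * Y)) = X $$ (c, c) \<cdot>\<^sub>m (E * Y)" if "X \<in> M" "Y \<in> M" for X Y
    using that c diag_unit_sandwich[of X c] mult_eq_assoc[of E "X * E" _ Y] by (simp add: E_def)
  define R where "R = (1 / p) \<cdot>\<^sub>m (P * (E * P))"
  have "R * (X * R) = ((P * (X * P)) $$ (c, c) / p) \<cdot>\<^sub>m R" if "X \<in> M" for X
    using that EXE[of "P * (X * P)" P] by (simp add: R_def)
  moreover have "trace (P * (E * P)) = p"
    using trace_mult_commute[of P n n "E * P"] trace_diag_unit_mult[of P c] c
    by (simp add: E_def p_def)
  then have "trace R = 1" using p by (simp add: R_def)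
  moreover have "projection R"
    using p by (simp add: projection_def R_def EXE p_def[symmetric])
  moreover have "P * R = R" "R * P = R" by (simp_all add: R_def)
  ultimately show thesis using that by blast
qed

lemma projection_trace_ge_1:
  assumes "projection P" "P \<noteq> 0\<^sub>m n n"
  shows "1 \<le> trace P"
proof -
  obtain R where R: "projection R" "trace R = 1" "P * R = R" "R * P = R"
    using rank_one_subprojection[OF assms] by blast
  have "0 \<le> trace (P - R)"
    by (intro projection_trace_nonneg projection_diff assms R)
  then show ?thesis using R(1,2) assms(1) by (simp add: projection_def)
qed

lemma commuting_trace_one_projection:
  assumes P: "projection P" "trace P = 1" and X: "X \<in> M" "commuting X P"
  obtains c where "X * P = c \<cdot>\<^sub>m P"
proof -
  have "P \<noteq> 0\<^sub>m n n" using P projection_trace_eq_0_iff[OF P(1)] by auto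
  then obtain R where R: "projection R" "trace R = 1" "P * R = R" "R * P = R"
    and RXR: "\<And>Y. Y \<in> M \<Longrightarrow> \<exists>c. R * (Y * R) = c \<cdot>\<^sub>m R"
    using rank_one_subprojection[OF P(1)] by blast
  note [simp] = projectionD[OF P(1)]
  have "trace (P - R) = 0" using P R by (simp add: projection_def)
  then have "P = R"
    using projection_trace_eq_0_iff[OF projection_diff[OF P(1) R(1,3,4)]] projectionD(1)[OF R(1)]
    by (simp add: diff_eq_zero_mat_iff)
  then obtain c where "P * (X * P) = c \<cdot>\<^sub>m P" using RXR[OF X(1)] by blast
  moreover have "P * (X * P) = X * P"
    using X mult_eq_assoc[OF projectionD(3)[OF P(1)]] by simp
  ultimately show thesis using that by simp
qed

definition hermitian_involution :: "complex mat \<Rightarrow> bool" where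
  "hermitian_involution T \<longleftrightarrow> T \<in> M \<and> mat_adjoint T = T \<and> T * T = I"

lemma hermitian_involutionD:
  assumes "hermitian_involution T"
  shows "T \<in> M" "mat_adjoint T = T" "T * T = I"
  using assms by (simp_all add: hermitian_involution_def)

lemma involution_in_span:
  assumes n: "n > 0" and D: "D \<in> M" "D * D = I" and X: "X = x \<cdot>\<^sub>m I + y \<cdot>\<^sub>m D" "X * X = I"
  shows "X = I \<or> X = - I \<or> X = D \<or> X = - D"
proof -
  note [simp] = D
  have scalar: "c = 1 \<or> c = - 1" if "(c * c) \<cdot>\<^sub>m I = I" for c :: complex
  proof -
    have "(c * c) \<cdot>\<^sub>m I = 1 \<cdot>\<^sub>m I" using that by simp
    then have "c * c = 1" using n by (simp only: smult_one_mat_cancel)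
    then show ?thesis by (simp add: square_eq_1_iff)
  qed
  consider (no_one) "x = 0" | (no_involution) "y = 0" | (both) "x \<noteq> 0" "y \<noteq> 0" by blast
  then show ?thesis
  proof cases
    case no_one
    then show ?thesis using X scalar[of y] by auto
  next
    case no_involution
    then show ?thesis using X scalar[of x] by auto
  next
    case both
    define w where "w = (1 - x * x - y * y) / (2 * x * y)"
    have "I = (x \<cdot>\<^sub>m I + y \<cdot>\<^sub>m D) * (x \<cdot>\<^sub>m I + y \<cdot>\<^sub>m D)" using X by simp
    also have "\<dots> = (x * x + y * y) \<cdot>\<^sub>m I + (2 * x * y) \<cdot>\<^sub>m D"
      by (simp add: square_distribs) (auto intro!: eq_matI simp: algebra_simps)
    finally have XX: "I = (x * x + y * y) \<cdot>\<^sub>m I + (2 * x * y) \<cdot>\<^sub>m D" .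
    have "D = w \<cdot>\<^sub>m I"
    proof (rule eq_matI)
      fix i j assume "i < dim_row (w \<cdot>\<^sub>m I)" "j < dim_col (w \<cdot>\<^sub>m I)"
      then show "D $$ (i, j) = (w \<cdot>\<^sub>m I) $$ (i, j)"
        using arg_cong[OF XX, of "\<lambda>A. A $$ (i, j)"] both by (auto simp: w_def field_simps)
    qed simp_all
    then have X_scalar: "X = (x + y * w) \<cdot>\<^sub>m I"
      using X(1) by (simp add: add_smult_distrib_right_mat[of _ n n])
    then show ?thesis using X(2) scalar[of "x + y * w"] by auto
  qed
qed

lemma projection_half_involution:
  assumes P: "projection P" and T: "hermitian_involution T" and TP: "commuting T P"
  shows "projection ((1/2) \<cdot>\<^sub>m (P + T * P))" "projection ((1/2) \<cdot>\<^sub>m (P - T * P))"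
proof -
  note P' = projectionD[OF P] and T' = hermitian_involutionD[OF T]
  note [simp] = P' T' TP[symmetric] mult_eq_assoc[OF TP[symmetric]] mult_eq_assoc[OF T'(3)]
    mult_eq_assoc[OF P'(3)]
  have halves: "(1/2) \<cdot>\<^sub>m ((1/2) \<cdot>\<^sub>m (A + B) + (1/2) \<cdot>\<^sub>m (B + A)) = (1/2) \<cdot>\<^sub>m (A + B)"
    "(1/2) \<cdot>\<^sub>m ((1/2) \<cdot>\<^sub>m (A - B) - (1/2) \<cdot>\<^sub>m (B - A)) = (1/2) \<cdot>\<^sub>m (A - B)"
    if "A \<in> M" "B \<in> M" for A B :: "complex mat"
    using that by (auto intro!: eq_matI simp: field_simps)
  show "projection ((1/2) \<cdot>\<^sub>m (P + T * P))" "projection ((1/2) \<cdot>\<^sub>m (P - T * P))"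
    by (simp_all add: projection_def square_distribs halves)
qed

subsection \<open>Anticommuting skew-Hermitian unitaries\<close>

definition skew_unitary :: "complex mat \<Rightarrow> bool" where
  "skew_unitary A \<longleftrightarrow> A \<in> M \<and> mat_adjoint A = - A \<and> A * A = - I"

lemma skew_unitaryD:
  assumes "skew_unitary A"
  shows "A \<in> M" "mat_adjoint A = - A" "A * A = - I" "X \<in> M \<Longrightarrow> A * (A * X) = - X"
  using assms mult_eq_assoc[of A A "- I" X] by (simp_all add: skew_unitary_def)

lemma skew_unitary_if_orthogonal_one:
  assumes "A \<in> M" "mat_adjoint A * A = I" "mat_adjoint I * A + mat_adjoint A * I = 0\<^sub>m n n"
  shows "skew_unitary A"
proof -
  have "A = - mat_adjoint A"
    using assms(1,3) add_eq_zero_mat_iff[of A n n "mat_adjoint A"] by simp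
  then have skew: "mat_adjoint A = - A" by (metis uminus_uminus_mat)
  then have "- (A * A) = I" using assms(1,2) by simp
  then have "A * A = - I" by (metis uminus_uminus_mat)
  then show ?thesis using assms(1) skew by (simp add: skew_unitary_def)
qed

lemma skew_unitary_orthogonal_iff:
  assumes "skew_unitary A" "skew_unitary B"
  shows "mat_adjoint A * B + mat_adjoint B * A = 0\<^sub>m n n \<longleftrightarrow> anticommuting A B"
proof -
  note [simp] = skew_unitaryD(1,2)[OF assms(1)] skew_unitaryD(1,2)[OF assms(2)]
  have "mat_adjoint A * B + mat_adjoint B * A = - (A * B) + - (B * A)" by simp
  moreover have "- (A * B) + - (B * A) = 0\<^sub>m n n \<longleftrightarrow> - (A * B) = - (- (B * A))"
    by (rule add_eq_zero_mat_iff) simp_all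
  ultimately show ?thesis by (simp only: uminus_eq_mat)
qed

lemma skew_unitary_orthogonalD:
  assumes A: "skew_unitary A" and D: "D \<in> M"
    and ortho: "mat_adjoint A * D + mat_adjoint D * A = 0\<^sub>m n n"
  shows "mat_adjoint D * A = A * D" "D * A = A * mat_adjoint D"
proof -
  note [simp] = skew_unitaryD[OF A] D
  show DA: "mat_adjoint D * A = A * D"
    using ortho add_eq_zero_mat_iff[of "- (A * D)" n n "mat_adjoint D * A"] by simp
  have "- (D * A) = A * (A * D) * A" by simp
  also have "\<dots> = A * (mat_adjoint D * A) * A" unfolding DA ..
  also have "\<dots> = - (A * mat_adjoint D)" by simp
  finally show "D * A = A * mat_adjoint D" by simp
qed

definition clifford :: "complex mat list \<Rightarrow> bool" where
  "clifford es \<longleftrightarrow> (\<forall>e\<in>set es. skew_unitary e) \<and> sorted_wrt (\<lambda>x y. anticommuting x y) es"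

lemma clifford_Cons:
  "clifford (e # es) \<longleftrightarrow> skew_unitary e \<and> (\<forall>f\<in>set es. anticommuting e f) \<and> clifford es"
  by (auto simp: clifford_def)

lemma clifford_carrier: "clifford es \<Longrightarrow> e \<in> set es \<Longrightarrow> e \<in> M"
  by (auto simp: clifford_def skew_unitary_def)

text \<open>The Hermitian involution \<open>\<i> e f\<close> cuts \<open>P\<close> into two halves exchanged by conjugation with \<open>e\<close>.\<close>

lemma projection_conjugate_halves:
  assumes P: "projection P" and e: "skew_unitary e" and f: "skew_unitary f"
    and ef: "anticommuting e f" and eP: "commuting e P" and fP: "commuting f P"
  obtains Q where "projection Q" "P = Q - e * (Q * e)"
    "\<And>X. \<lbrakk>X \<in> M; commuting X P; commuting X (e * f)\<rbrakk> \<Longrightarrow> commuting X Q"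
proof -
  note PD = projectionD[OF P] and eD = skew_unitaryD[OF e] and fD = skew_unitaryD[OF f]
  have fe: "f * e = - (e * f)" using ef by simp
  note [simp] = PD eD fD fe mult_eq_assoc[OF fe] eP[symmetric] mult_eq_assoc[OF eP[symmetric]]
    fP[symmetric] mult_eq_assoc[OF fP[symmetric]]
  define T where "T = \<i> \<cdot>\<^sub>m (e * f)"
  have T: "hermitian_involution T" and TP: "commuting T P" and eT: "e * (T * e) = T"
    by (simp_all add: T_def hermitian_involution_def)
  note TD = hermitian_involutionD[OF T]
  define Q where "Q = (1/2) \<cdot>\<^sub>m (P + T * P)"
  have "e * (Q * e) = (1/2) \<cdot>\<^sub>m (T * P - P)"
  proof -
    have "e * ((P + T * P) * e) = e * (P * e) + e * (T * e) * P"
      using TD(1) by (simp add: square_distribs)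
    also have "\<dots> = T * P - P"
      unfolding eT using TD(1) by (auto intro!: eq_matI)
    finally show ?thesis using TD(1) by (simp add: Q_def)
  qed
  then have "P = Q - e * (Q * e)"
    using PD(1) TD(1) by (auto intro!: eq_matI simp: Q_def field_simps)
  moreover have "commuting X Q" if X: "X \<in> M" "commuting X P" "commuting X (e * f)" for X
  proof -
    have "commuting X T" using X by (simp add: T_def)
    then have "commuting X (T * P)" by (intro commuting_mult_right X TD PD)
    then show ?thesis using X TD(1) by (simp add: Q_def square_distribs)
  qed
  moreover have "projection Q" unfolding Q_def by (rule projection_half_involution[OF P T TP])
  ultimately show thesis using that by blast
qed

lemma projection_halving:
  assumes P: "projection P" and e: "skew_unitary e" and f: "skew_unitary f"
    and ef: "anticommuting e f" and eP: "commuting e P" and fP: "commuting f P"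
  obtains Q where "projection Q" "trace P = 2 * trace Q"
    "\<And>X. \<lbrakk>X \<in> M; commuting X P; commuting X (e * f)\<rbrakk> \<Longrightarrow> commuting X Q"
    "\<And>X. \<lbrakk>X \<in> M; commuting X e \<or> anticommuting X e; X * Q = 0\<^sub>m n n\<rbrakk> \<Longrightarrow> X * P = 0\<^sub>m n n"
proof -
  obtain Q where Q: "projection Q" and PQ: "P = Q - e * (Q * e)"
    and comm: "\<And>X. \<lbrakk>X \<in> M; commuting X P; commuting X (e * f)\<rbrakk> \<Longrightarrow> commuting X Q"
    using projection_conjugate_halves[OF assms] by blast
  note [simp] = skew_unitaryD[OF e] projectionD[OF Q]
  have "trace (e * (Q * e)) = - trace Q"
    using trace_mult_commute[of e n n "Q * e"] by simp
  then have "trace P = 2 * trace Q" unfolding PQ by simp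
  moreover have "X * P = 0\<^sub>m n n"
    if X: "X \<in> M" "commuting X e \<or> anticommuting X e" and XQ: "X * Q = 0\<^sub>m n n" for X
  proof -
    have "X * (e * (Q * e)) = 0\<^sub>m n n"
      using X mult_eq_assoc[OF XQ, of e] mult_eq_assoc[of X e "e * X" "Q * e"]
        mult_eq_assoc[of X e "- (e * X)" "Q * e"] by auto
    then show ?thesis using X(1) XQ by (simp add: PQ square_distribs)
  qed
  ultimately show thesis using that Q comm by blast
qed

definition homogeneous :: "complex mat list \<Rightarrow> complex mat \<Rightarrow> bool" where
  "homogeneous es X \<longleftrightarrow>
     X \<in> M \<and> ((\<forall>e\<in>set es. commuting X e) \<or> (\<forall>e\<in>set es. anticommuting X e))"

lemma homogeneous_commuting_mult:
  assumes "homogeneous es X" "e \<in> set es" "f \<in> set es" "e \<in> M" "f \<in> M"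
  shows "commuting X (e * f)"
proof -
  have "X \<in> M" "commuting X e \<and> commuting X f \<or> anticommuting X e \<and> anticommuting X f"
    using assms(1-3) by (auto simp: homogeneous_def)
  then show ?thesis
    using commuting_mult_right[of X e f] anticommuting_mult_right[of X e f] assms(4,5) by blast
qed

text \<open>\<open>Q\<close> arises from \<open>P\<close> and products of two generators, with which homogeneous matrices commute.\<close>

lemma clifford_reduction:
  assumes "clifford es" "length es = 2 * l" "projection P" "\<forall>e\<in>set es. commuting e P"
  shows "\<exists>Q. projection Q \<and> trace P = 2 ^ l * trace Q \<and>
    (\<forall>X. homogeneous es X \<longrightarrow>
      (commuting X P \<longrightarrow> commuting X Q) \<and> (X * Q = 0\<^sub>m n n \<longrightarrow> X * P = 0\<^sub>m n n))"
  using assms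
proof (induction l arbitrary: es P)
  case 0
  then show ?case by auto
next
  case (Suc l)
  obtain e f gs where es: "es = e # f # gs" and len: "length gs = 2 * l"
    using Suc.prems(2) by (cases es; cases "tl es") auto
  have e: "skew_unitary e" and f: "skew_unitary f" and ef: "anticommuting e f" and gs: "clifford gs"
    and anti: "\<forall>g\<in>set gs. anticommuting e g \<and> anticommuting f g"
    using Suc.prems(1) by (auto simp: es clifford_Cons)
  have commP: "commuting e P" "commuting f P" "\<forall>g\<in>set gs. commuting g P"
    using Suc.prems(4) by (auto simp: es)
  obtain Q where Q: "projection Q" "trace P = 2 * trace Q"
    and comm: "\<And>X. \<lbrakk>X \<in> M; commuting X P; commuting X (e * f)\<rbrakk> \<Longrightarrow> commuting X Q"
    and faithful: "\<And>X. \<lbrakk>X \<in> M; commuting X e \<or> anticommuting X e; X * Q = 0\<^sub>m n n\<rbrakk>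
      \<Longrightarrow> X * P = 0\<^sub>m n n"
    using projection_halving[OF Suc.prems(3) e f ef commP(1,2)] by blast
  note [simp] = skew_unitaryD(1)[OF e] skew_unitaryD(1)[OF f]
  have "commuting g Q" if g: "g \<in> set gs" for g
  proof -
    have gM: "g \<in> M" by (rule clifford_carrier[OF gs g])
    then have "homogeneous [e, f] g" using anti g by (simp add: homogeneous_def)
    then have "commuting g (e * f)" by (rule homogeneous_commuting_mult) simp_all
    then show ?thesis using comm gM commP(3) g by blast
  qed
  then obtain R where R: "projection R" "trace Q = 2 ^ l * trace R"
    and homR: "\<And>X. homogeneous gs X \<Longrightarrow>
      (commuting X Q \<longrightarrow> commuting X R) \<and> (X * R = 0\<^sub>m n n \<longrightarrow> X * Q = 0\<^sub>m n n)"
    using Suc.IH[OF gs len Q(1)] by blast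
  have "(commuting X P \<longrightarrow> commuting X R) \<and> (X * R = 0\<^sub>m n n \<longrightarrow> X * P = 0\<^sub>m n n)"
    if "homogeneous es X" for X
  proof -
    have "X \<in> M" "homogeneous gs X" "commuting X e \<or> anticommuting X e"
      using that by (auto simp: homogeneous_def es)
    moreover have "commuting X (e * f)"
      using homogeneous_commuting_mult[OF that, of e f] by (simp add: es)
    ultimately show ?thesis using comm faithful homR by blast
  qed
  moreover have "trace P = 2 ^ Suc l * trace R" by (simp add: Q(2) R(2))
  ultimately show ?case using R(1) by blast
qed

lemma clifford_multiplicity_projection:
  assumes "clifford es" "length es = 2 * l" "n = m * 2 ^ l"
  obtains Q where "projection Q" "trace Q = of_nat m"
    "\<And>X. homogeneous es X \<Longrightarrow> commuting X Q"
    "\<And>X. \<lbrakk>homogeneous es X; X * Q = 0\<^sub>m n n\<rbrakk> \<Longrightarrow> X = 0\<^sub>m n n"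
proof -
  have "\<forall>e\<in>set es. commuting e I" using clifford_carrier[OF assms(1)] by simp
  then obtain Q where Q: "projection Q" "trace I = 2 ^ l * trace Q"
    and hom: "\<And>X. homogeneous es X \<Longrightarrow>
      (commuting X I \<longrightarrow> commuting X Q) \<and> (X * Q = 0\<^sub>m n n \<longrightarrow> X * I = 0\<^sub>m n n)"
    using clifford_reduction[OF assms(1,2) projection_one] by blast
  have "trace Q = of_nat m" using Q(2) assms(3) by simp
  then show thesis using that Q(1) hom by (simp add: homogeneous_def)
qed

subsection \<open>Commutants\<close>

lemma commutant_trace_two_projection:
  assumes Q: "projection Q" "trace Q = 2"
    and N: "hermitian_involution N" "commuting N Q" "N * Q \<noteq> Q" "N * Q \<noteq> - Q"
    and X: "X \<in> M" "commuting X Q" "commuting X N"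
  obtains x y where "X * Q = x \<cdot>\<^sub>m Q + y \<cdot>\<^sub>m (N * Q)"
proof -
  note [simp] = projectionD[OF Q(1)] hermitian_involutionD[OF N(1)] X(1)
  define R where "R = (1/2) \<cdot>\<^sub>m (Q + N * Q)"
  define S where "S = (1/2) \<cdot>\<^sub>m (Q - N * Q)"
  have proj: "projection R" "projection S"
    unfolding R_def S_def by (rule projection_half_involution[OF Q(1) N(1,2)])+
  note [simp] = projectionD(1)[OF proj(1)] projectionD(1)[OF proj(2)]
  have S: "S = Q - R"
    using projectionD(1)[OF Q(1)] hermitian_involutionD(1)[OF N(1)]
    by (auto intro!: eq_matI simp: R_def S_def field_simps)
  have "Q \<noteq> - (N * Q)" using N(4) by (metis uminus_uminus_mat)
  then have "R \<noteq> 0\<^sub>m n n"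
    using add_eq_zero_mat_iff[of Q n n "N * Q"] by (auto simp: R_def)
  then have geR: "1 \<le> trace R" by (rule projection_trace_ge_1[OF proj(1)])
  have "S \<noteq> 0\<^sub>m n n"
    using N(3) diff_eq_zero_mat_iff[of Q n n "N * Q"] by (auto simp: S_def)
  then have "1 \<le> trace S" by (rule projection_trace_ge_1[OF proj(2)])
  then have tr: "trace R = 1" "trace S = 1"
    using geR Q(2) by (auto simp: S less_eq_complex_def complex_eq_iff)
  have "commuting X (N * Q)" by (intro commuting_mult_right X) simp_all
  then have comm: "commuting X R" "commuting X S"
    using X(2) by (simp_all add: R_def S square_distribs)
  obtain c d where c: "X * R = c \<cdot>\<^sub>m R" and d: "X * S = d \<cdot>\<^sub>m S"
    using commuting_trace_one_projection[OF proj(1) tr(1) X(1) comm(1)]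
      commuting_trace_one_projection[OF proj(2) tr(2) X(1) comm(2)] by metis
  have "X * Q = X * (R + S)"
    using projectionD(1)[OF Q(1)] by (intro arg_cong[of _ _ "(*) X"] eq_matI) (simp_all add: S)
  also have "\<dots> = X * R + X * S" by (simp add: square_distribs)
  also have "\<dots> = ((c + d) / 2) \<cdot>\<^sub>m Q + ((c - d) / 2) \<cdot>\<^sub>m (N * Q)"
    unfolding c d by (auto intro!: eq_matI simp: R_def S_def field_simps)
  finally show thesis using that by blast
qed

text \<open>\<open>F\<close> exchanges the two eigenlines of \<open>N\<close> in the range of \<open>Q\<close>, so \<open>X\<close> has the same
  eigenvalue on both.\<close>

lemma commutant_trace_two_projection_anticommuting:
  assumes Q: "projection Q" "trace Q = 2"
    and N: "hermitian_involution N" "commuting N Q"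
    and F: "F \<in> M" "commuting F Q" "anticommuting F N" "F * Q \<noteq> 0\<^sub>m n n"
    and X: "X \<in> M" "commuting X Q" "commuting X N" "commuting X F"
  obtains x where "X * Q = x \<cdot>\<^sub>m Q"
proof -
  note [simp] = projectionD[OF Q(1)] hermitian_involutionD[OF N(1)] F(1) X(1)
  have FNQ: "F * (N * Q) = - (N * (F * Q))" using mult_eq_assoc[OF F(3)] by simp
  have NFQ: "N * (F * Q) \<noteq> 0\<^sub>m n n"
  proof
    assume "N * (F * Q) = 0\<^sub>m n n"
    then have "N * (N * (F * Q)) = 0\<^sub>m n n" by simp
    then show False using F(4) mult_eq_assoc[OF hermitian_involutionD(3)[OF N(1)]] by simp
  qed
  have NQ: "N * Q \<noteq> s \<cdot>\<^sub>m Q" for s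
  proof
    assume NQs: "N * Q = s \<cdot>\<^sub>m Q"
    have "N * (F * Q) = N * Q * F" by (simp add: F(2))
    also have "\<dots> = F * (N * Q)" by (simp add: NQs F(2))
    finally show False using FNQ NFQ eq_uminus_mat_iff[of "N * (F * Q)" n n] by simp
  qed
  obtain x y where xy: "X * Q = x \<cdot>\<^sub>m Q + y \<cdot>\<^sub>m (N * Q)"
    using commutant_trace_two_projection[OF Q N _ _ X(1-3)] NQ[of 1] NQ[of "- 1"] by auto
  define W where "W = X - x \<cdot>\<^sub>m I"
  have W [simp]: "W \<in> M" and WQ: "W * Q = y \<cdot>\<^sub>m (N * Q)" and WF: "commuting W F"
    using xy X(4) by (auto simp: W_def square_distribs)
  have "y \<cdot>\<^sub>m (N * (F * Q)) = W * Q * F" unfolding WQ by (simp add: F(2))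
  also have "\<dots> = F * (W * Q)" by (simp add: F(2)[symmetric] mult_eq_assoc[OF WF])
  also have "\<dots> = - (y \<cdot>\<^sub>m (N * (F * Q)))" unfolding WQ by (simp add: FNQ)
  finally have "y = 0"
    using NFQ eq_uminus_mat_iff[of "y \<cdot>\<^sub>m (N * (F * Q))" n n] by simp
  then show thesis using xy that by simp
qed

lemma commutant_clifford_involution:
  assumes es: "clifford es" "length es = 2 * l" "n = 2 * 2 ^ l"
    and D: "hermitian_involution D" "D \<noteq> I" "D \<noteq> - I" "\<forall>e\<in>set es. commuting D e"
    and X: "X \<in> M" "\<forall>e\<in>set es. commuting X e" "commuting X D"
  obtains x y where "X = x \<cdot>\<^sub>m I + y \<cdot>\<^sub>m D"
proof -
  obtain Q where Q: "projection Q" "trace Q = 2"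
    and comm: "\<And>Y. homogeneous es Y \<Longrightarrow> commuting Y Q"
    and faithful: "\<And>Y. \<lbrakk>homogeneous es Y; Y * Q = 0\<^sub>m n n\<rbrakk> \<Longrightarrow> Y = 0\<^sub>m n n"
    using clifford_multiplicity_projection[OF es] by auto
  note [simp] = projectionD[OF Q(1)] hermitian_involutionD[OF D(1)] X(1)
  note esM = clifford_carrier[OF es(1)]
  have DX: "D * e = e * D" "X * e = e * X" if "e \<in> set es" for e using D(4) X(2) that by simp_all
  have DQ: "commuting D Q" and XQ: "commuting X Q"
    using D(4) X(2) by (simp_all add: comm homogeneous_def)
  have DQ_neq: "D * Q \<noteq> Q"
  proof
    assume "D * Q = Q"
    then have "D - I = 0\<^sub>m n n"
      by - (rule faithful, auto simp: homogeneous_def square_distribs DX esM)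
    then show False using D(2) by (simp add: diff_eq_zero_mat_iff)
  qed
  have DQ_neq_uminus: "D * Q \<noteq> - Q"
  proof
    assume "D * Q = - Q"
    then have "D + I = 0\<^sub>m n n"
      by - (rule faithful, auto simp: homogeneous_def square_distribs DX esM)
    then show False using D(3) by (simp add: add_eq_zero_mat_iff)
  qed
  obtain x y where xy: "X * Q = x \<cdot>\<^sub>m Q + y \<cdot>\<^sub>m (D * Q)"
    by (rule commutant_trace_two_projection[OF Q D(1) DQ DQ_neq DQ_neq_uminus X(1) XQ X(3)])
  have "X - (x \<cdot>\<^sub>m I + y \<cdot>\<^sub>m D) = 0\<^sub>m n n"
    by (rule faithful) (auto simp: homogeneous_def square_distribs DX esM xy)
  then show thesis using that by (simp add: diff_eq_zero_mat_iff)
qed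

definition scalar_commutant :: "complex mat set \<Rightarrow> bool" where
  "scalar_commutant S \<longleftrightarrow> (\<forall>X\<in>M. (\<forall>A\<in>S. commuting X A) \<longrightarrow> (\<exists>c. X = c \<cdot>\<^sub>m I))"

lemma scalar_commutant_clifford_anticommuting:
  assumes es: "clifford (e # es)" "length es = 2 * l" and n: "n = 2 * 2 ^ l"
    and F: "F \<in> M" "F \<noteq> 0\<^sub>m n n" "\<forall>g\<in>set (e # es). anticommuting F g"
  shows "scalar_commutant (insert F (set (e # es)))"
  unfolding scalar_commutant_def
proof (intro ballI impI)
  fix X assume X: "X \<in> M" and XS: "\<forall>A\<in>insert F (set (e # es)). commuting X A"
  have e: "skew_unitary e" and anti: "\<forall>f\<in>set es. anticommuting e f" and cl: "clifford es"
    using es(1) by (simp_all add: clifford_Cons)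
  obtain Q where Q: "projection Q" "trace Q = 2"
    and comm: "\<And>Y. homogeneous es Y \<Longrightarrow> commuting Y Q"
    and faithful: "\<And>Y. \<lbrakk>homogeneous es Y; Y * Q = 0\<^sub>m n n\<rbrakk> \<Longrightarrow> Y = 0\<^sub>m n n"
    using clifford_multiplicity_projection[OF cl es(2) n] by auto
  note [simp] = projectionD[OF Q(1)] skew_unitaryD[OF e] F(1) X
  define N where "N = \<i> \<cdot>\<^sub>m e"
  have N: "hermitian_involution N" by (simp add: N_def hermitian_involution_def)
  have homF: "homogeneous es F" using F(3) by (simp add: homogeneous_def)
  have FQ: "commuting F Q" "F * Q \<noteq> 0\<^sub>m n n"
    using comm[OF homF] faithful[OF homF] F(2) by blast+
  have XQ: "commuting X Q" using XS by (simp add: comm homogeneous_def)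
  have "commuting e Q" using anti by (simp add: comm homogeneous_def)
  then have NQ: "commuting N Q" by (simp add: N_def)
  have "anticommuting F N" "commuting X N" "commuting X F"
    using F(3) XS by (simp_all add: N_def)
  then obtain x where "X * Q = x \<cdot>\<^sub>m Q"
    using commutant_trace_two_projection_anticommuting[OF Q N NQ F(1) FQ(1) _ FQ(2) X XQ] by blast
  then have "(X - x \<cdot>\<^sub>m I) * Q = 0\<^sub>m n n" by (simp add: square_distribs)
  moreover have "homogeneous es (X - x \<cdot>\<^sub>m I)"
    using XS clifford_carrier[OF cl] by (auto simp: homogeneous_def square_distribs)
  ultimately have "X - x \<cdot>\<^sub>m I = 0\<^sub>m n n" using faithful by blast
  then show "\<exists>c. X = c \<cdot>\<^sub>m I" by (auto simp: diff_eq_zero_mat_iff)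
qed

lemma scalar_commutant_anticommuting_correction:
  assumes n: "n > 0" and S: "scalar_commutant S" "S \<subseteq> M"
    and B: "B \<in> S" "skew_unitary B" "\<forall>A\<in>S - {B}. anticommuting B A"
    and C: "C \<in> M" "mat_adjoint C = - C" "\<forall>A\<in>S - {B}. anticommuting C A"
  obtains r :: real where "\<forall>A\<in>S. anticommuting (C - of_real r \<cdot>\<^sub>m B) A"
proof -
  note [simp] = skew_unitaryD[OF B(2)] C(1,2)
  define U where "U = C * B + B * C"
  have [simp]: "U \<in> M" by (simp add: U_def)
  have "commuting U A" if A: "A \<in> S" for A
  proof (cases "A = B")
    case True
    then show ?thesis by (simp add: U_def square_distribs comm_add_mat[of _ n n])
  next
    case False
    have AM: "A \<in> M" using A S(2) by blast
    have AC: "anticommuting A C" and AB: "anticommuting A B" using B(3) C(3) A False by simp_all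
    have "commuting A (C * B)" "commuting A (B * C)"
      by (intro anticommuting_mult_right AM C B AC AB skew_unitaryD(1)[OF B(2)])+
    then show ?thesis using AM by (simp add: U_def square_distribs)
  qed
  then obtain c where c: "U = c \<cdot>\<^sub>m I"
    using S(1) \<open>U \<in> M\<close> unfolding scalar_commutant_def by blast
  have "mat_adjoint U = U" by (simp add: U_def comm_add_mat[of _ n n])
  then have "cnj c = c"
    unfolding c using n by (simp add: smult_one_mat_cancel)
  then obtain r where r: "c = of_real r" by (metis Reals_cnj_iff Reals_cases)
  have "anticommuting (C - of_real (- r / 2) \<cdot>\<^sub>m B) A" if A: "A \<in> S" for A
  proof (cases "A = B")
    case True
    have "C * B = c \<cdot>\<^sub>m I - B * C"
      unfolding c[symmetric] by (auto simp: U_def)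
    then show ?thesis unfolding True by (auto intro!: eq_matI simp: square_distribs r)
  next
    case False
    then show ?thesis using A S(2) B(3) C(3) by (intro anticommuting_diff_smult) auto
  qed
  then show thesis using that by blast
qed

lemma anticommuting_pair_eq_zero:
  assumes S: "scalar_commutant S" "S \<subseteq> M"
    and Y: "Y \<in> M" "\<forall>A\<in>S. anticommuting Y A" "mat_adjoint Y = - Y"
    and Y': "Y' \<in> M" "\<forall>A\<in>S. anticommuting Y' A" "anticommuting Y' Y"
  shows "Y = 0\<^sub>m n n \<or> Y' = 0\<^sub>m n n"
proof -
  note [simp] = Y(1,3) Y'(1)
  have scalar: "\<exists>c. Y * W = c \<cdot>\<^sub>m I" if W: "W \<in> M" "\<forall>A\<in>S. anticommuting W A" for W
  proof -
    have "commuting A (Y * W)" if A: "A \<in> S" for A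
      using A S(2) Y W by (intro anticommuting_mult_right) auto
    then show ?thesis using S(1) W(1) Y(1) by (simp add: scalar_commutant_def)
  qed
  obtain c where c: "Y * Y = c \<cdot>\<^sub>m I" using scalar Y by blast
  obtain d where d: "Y * Y' = d \<cdot>\<^sub>m I" using scalar Y' by blast
  have "d \<cdot>\<^sub>m Y = Y * Y' * Y" unfolding d by simp
  also have "\<dots> = - (Y * (Y * Y'))" using Y'(3) by simp
  also have "\<dots> = - (d \<cdot>\<^sub>m Y)" unfolding d by simp
  finally have "d = 0 \<or> Y = 0\<^sub>m n n" using eq_uminus_mat_iff[of "d \<cdot>\<^sub>m Y" n n] by simp
  moreover have "c \<cdot>\<^sub>m Y' = Y * (Y * Y')" using mult_eq_assoc[OF c] by simp
  then have "c \<cdot>\<^sub>m Y' = d \<cdot>\<^sub>m Y" unfolding d by simp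
  moreover have "Y = 0\<^sub>m n n" if "c = 0"
    using that c trace_adjoint_mult_eq_0_iff[OF Y(1)] by simp
  ultimately show ?thesis by auto
qed

end

subsection \<open>Unitary-weight single-symbol decodable codes\<close>

lemma real_lin_indep_weights_not_real_multiple:
  assumes ind: "real_lin_indep_weights n k AI AQ" and i: "i \<in> {1..k}"
    and AI: "AI i \<in> carrier_mat n n"
  shows "AQ i \<noteq> of_real r \<cdot>\<^sub>m AI i"
proof
  assume eq: "AQ i = of_real r \<cdot>\<^sub>m AI i"
  define c where "c j = (if j = i then r else 0)" for j
  define d where "d j = (if j = i then - 1 else 0 :: real)" for j
  have "(\<Sum>j\<in>{1..k}. complex_of_real (c j) * AI j $$ (s, t)
      + complex_of_real (d j) * AQ j $$ (s, t)) = 0" if "s < n" "t < n" for s t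
    using that AI by (intro sum.neutral) (auto simp: c_def d_def eq)
  then have "d i = 0" using ind i unfolding real_lin_indep_weights_def by blast
  then show False by (simp add: d_def)
qed

locale normalized_SSD = square_mats n for n +
  fixes k :: nat and AI AQ :: "nat \<Rightarrow> complex mat"
  assumes SSD: "unitary_weight_SSD n k AI AQ" and normalized: "normalized_STBC n AI"
    and k_pos: "1 \<le> k"
begin

lemma AI_1: "AI 1 = I"
  using normalized by (simp add: normalized_STBC_def)

lemma weight_carrier: "i \<in> {1..k} \<Longrightarrow> AI i \<in> M" "i \<in> {1..k} \<Longrightarrow> AQ i \<in> M"
  using SSD by (auto simp: unitary_weight_SSD_def)

lemma weight_unitary:
  "i \<in> {1..k} \<Longrightarrow> mat_adjoint (AI i) * AI i = I" "i \<in> {1..k} \<Longrightarrow> mat_adjoint (AQ i) * AQ i = I"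
  using SSD by (auto simp: unitary_weight_SSD_def)

lemma weight_orthogonal:
  assumes "i \<in> {1..k}" "j \<in> {1..k}" "i \<noteq> j"
  shows "mat_adjoint (AI i) * AI j + mat_adjoint (AI j) * AI i = 0\<^sub>m n n"
    "mat_adjoint (AQ i) * AQ j + mat_adjoint (AQ j) * AQ i = 0\<^sub>m n n"
    "mat_adjoint (AI i) * AQ j + mat_adjoint (AQ j) * AI i = 0\<^sub>m n n"
  using SSD assms by (auto simp: unitary_weight_SSD_def)

lemma AQ_not_real_multiple: "i \<in> {1..k} \<Longrightarrow> AQ i \<noteq> of_real r \<cdot>\<^sub>m AI i"
  using SSD weight_carrier(1)
  by (intro real_lin_indep_weights_not_real_multiple) (auto simp: unitary_weight_SSD_def)

lemma skew_unitary_weights: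
  assumes "i \<in> {2..k}"
  shows "skew_unitary (AI i)" "skew_unitary (AQ i)"
  using assms weight_carrier[of i] weight_unitary[of i]
    weight_orthogonal(1)[of 1 i, unfolded AI_1] weight_orthogonal(3)[of 1 i, unfolded AI_1]
  by (auto intro!: skew_unitary_if_orthogonal_one)

lemma anticommuting_weights:
  assumes "i \<in> {2..k}" "j \<in> {2..k}" "i \<noteq> j"
  shows "anticommuting (AI i) (AI j)" "anticommuting (AQ i) (AQ j)" "anticommuting (AI i) (AQ j)"
    "anticommuting (AQ i) (AI j)"
proof -
  have ij: "i \<in> {1..k}" "j \<in> {1..k}" using assms by auto
  note ortho = weight_orthogonal[OF ij assms(3)]
  note AI = skew_unitary_weights(1)[OF assms(1)] skew_unitary_weights(1)[OF assms(2)]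
    and AQ = skew_unitary_weights(2)[OF assms(1)] skew_unitary_weights(2)[OF assms(2)]
  show "anticommuting (AI i) (AI j)" using ortho(1) skew_unitary_orthogonal_iff[OF AI] by simp
  show "anticommuting (AQ i) (AQ j)" using ortho(2) skew_unitary_orthogonal_iff[OF AQ] by simp
  show "anticommuting (AI i) (AQ j)"
    using ortho(3) skew_unitary_orthogonal_iff[OF AI(1) AQ(2)] by simp
  show "anticommuting (AQ i) (AI j)"
    using weight_orthogonal(3)[OF ij(2,1)] assms(3) skew_unitary_orthogonal_iff[OF AI(2) AQ(1)]
    by simp
qed

lemma clifford_map_AI:
  assumes "distinct js" "set js \<subseteq> {2..k}"
  shows "clifford (map AI js)"
  using assms
proof (induction js)
  case (Cons j js)
  then have "\<forall>i\<in>set js. anticommuting (AI j) (AI i)" by (intro ballI anticommuting_weights) auto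
  then show ?case using Cons skew_unitary_weights(1)[of j] by (auto simp: clifford_Cons)
qed (simp add: clifford_def)

definition A1Q :: "complex mat" where
  "A1Q = AQ 1"

lemma A1Q_carrier: "A1Q \<in> M"
  using weight_carrier(2)[of 1] k_pos by (simp add: A1Q_def)

lemma A1Q_unitary: "mat_adjoint A1Q * A1Q = I"
  using weight_unitary(2)[of 1] k_pos by (simp add: A1Q_def)

lemma A1Q_not_real_multiple: "A1Q \<noteq> of_real r \<cdot>\<^sub>m I"
  using AQ_not_real_multiple[of 1 r] k_pos unfolding A1Q_def AI_1 by simp

lemma intertwine_A1Q:
  assumes "i \<in> {2..k}" "A \<in> {AI i, AQ i}"
  shows "mat_adjoint A1Q * A = A * A1Q" "A1Q * A = A * mat_adjoint A1Q"
proof -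
  have "skew_unitary A" using assms skew_unitary_weights by auto
  moreover have "mat_adjoint A * A1Q + mat_adjoint A1Q * A = 0\<^sub>m n n"
    using assms weight_orthogonal(2,3)[of i 1] by (auto simp: A1Q_def)
  ultimately show "mat_adjoint A1Q * A = A * A1Q" "A1Q * A = A * mat_adjoint A1Q"
    using A1Q_carrier skew_unitary_orthogonalD by blast+
qed

end

locale maximal_rate_SSD = normalized_SSD +
  fixes a :: nat
  assumes a: "2 \<le> a" and dim: "n = 2 ^ a" and rate: "k = 2 * a"
begin

lemma dim_eq_double: "n = 2 * 2 ^ (a - 1)"
  using a by (simp add: dim flip: power_Suc)

lemma scalar_commutant_weights:
  assumes "F \<in> M" "F \<noteq> 0\<^sub>m n n" "\<forall>i\<in>{2..k}. anticommuting F (AI i)"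
  shows "scalar_commutant (insert F (AI ` {2..k}))"
proof -
  have "{2..k} = insert 2 {3..k}" using a rate by auto
  then have AI: "set (AI 2 # map AI [3..<Suc k]) = AI ` {2..k}" by auto
  moreover have "clifford (map AI (2 # [3..<Suc k]))"
    using a rate by (intro clifford_map_AI) auto
  moreover have "length (map AI [3..<Suc k]) = 2 * (a - 1)" using a rate by simp
  moreover have "\<forall>A\<in>AI ` {2..k}. anticommuting F A" using assms(3) by blast
  ultimately show ?thesis
    using scalar_commutant_clifford_anticommuting[OF _ _ dim_eq_double assms(1,2)]
    unfolding list.map(2) by metis
qed

lemma anticommuting_real_correction:
  assumes F: "F \<in> M" "F \<noteq> 0\<^sub>m n n"
    and anti: "\<forall>i\<in>{2..k}. anticommuting F (AI i) \<and> anticommuting F (AQ i)"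
    and i: "i \<in> {2..k}"
  obtains r :: real
    where "\<forall>A\<in>insert F (AI ` {2..k}). anticommuting (AQ i - of_real r \<cdot>\<^sub>m AI i) A"
proof -
  define S where "S = insert F (AI ` {2..k})"
  have S: "scalar_commutant S" "S \<subseteq> M"
    using scalar_commutant_weights F anti weight_carrier(1) by (auto simp: S_def)
  have weights: "anticommuting (AI i) A \<and> anticommuting (AQ i) A" if A: "A \<in> S - {AI i}" for A
  proof -
    consider (extra) "A = F" | (weight) j where "j \<in> {2..k}" "j \<noteq> i" "A = AI j"
      using A unfolding S_def by blast
    then show ?thesis
    proof cases
      case extra
      then show ?thesis using anti i by simp
    next
      case (weight j)
      then show ?thesis using anticommuting_weights[OF i, of j] by simp
    qed
  qed
  have "n > 0" using dim by simp
  moreover have "AI i \<in> S" using i by (simp add: S_def)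
  moreover note skew_unitary_weights(1)[OF i] skew_unitaryD(1,2)[OF skew_unitary_weights(2)[OF i]]
  ultimately obtain r :: real where "\<forall>A\<in>S. anticommuting (AQ i - of_real r \<cdot>\<^sub>m AI i) A"
    using scalar_commutant_anticommuting_correction[OF _ S, of "AI i" "AQ i"] weights by metis
  then show thesis using that by (simp add: S_def)
qed

lemma anticommuting_weights_eq_zero:
  assumes F: "F \<in> M" "\<forall>i\<in>{2..k}. anticommuting F (AI i) \<and> anticommuting F (AQ i)"
  shows "F = 0\<^sub>m n n"
proof (rule ccontr)
  assume nz: "F \<noteq> 0\<^sub>m n n"
  have i2: "2 \<in> {2..k}" and i3: "3 \<in> {2..k}" using a rate by auto
  obtain r :: real
    where r: "\<forall>A\<in>insert F (AI ` {2..k}). anticommuting (AQ 2 - of_real r \<cdot>\<^sub>m AI 2) A"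
    by (rule anticommuting_real_correction[OF F(1) nz F(2) i2])
  obtain s :: real
    where s: "\<forall>A\<in>insert F (AI ` {2..k}). anticommuting (AQ 3 - of_real s \<cdot>\<^sub>m AI 3) A"
    by (rule anticommuting_real_correction[OF F(1) nz F(2) i3])
  define Y where "Y = AQ 2 - of_real r \<cdot>\<^sub>m AI 2"
  define Y' where "Y' = AQ 3 - of_real s \<cdot>\<^sub>m AI 3"
  note weights2 = skew_unitaryD(1,2)[OF skew_unitary_weights(1)[OF i2]]
    skew_unitaryD(1,2)[OF skew_unitary_weights(2)[OF i2]]
  note weights3 = skew_unitaryD(1)[OF skew_unitary_weights(1)[OF i3]]
    skew_unitaryD(1)[OF skew_unitary_weights(2)[OF i3]]
  have Y: "Y \<in> M" "mat_adjoint Y = - Y"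
    using weights2 by (auto intro!: eq_matI simp: Y_def)
  have Y': "Y' \<in> M" using weights3 by (simp add: Y'_def)
  have "anticommuting (AQ 2) Y'"
  proof -
    have "anticommuting Y' (AQ 2)" unfolding Y'_def
      by (intro anticommuting_diff_smult anticommuting_weights i2 i3 weights2 weights3) simp_all
    then show ?thesis by simp
  qed
  moreover have "anticommuting (AI 2) Y'" using s i2 by (simp add: Y'_def)
  ultimately have "anticommuting Y Y'" unfolding Y_def
    by (intro anticommuting_diff_smult weights2 Y')
  then have "anticommuting Y' Y" by simp
  moreover have "scalar_commutant (insert F (AI ` {2..k}))" "insert F (AI ` {2..k}) \<subseteq> M"
    using scalar_commutant_weights F nz weight_carrier(1) by auto
  ultimately have "Y = 0\<^sub>m n n \<or> Y' = 0\<^sub>m n n"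
    using anticommuting_pair_eq_zero Y Y' r s unfolding Y_def[symmetric] Y'_def[symmetric] by blast
  then show False
    using AQ_not_real_multiple[of 2 r] AQ_not_real_multiple[of 3 s] i2 i3 weights2 weights3
    by (auto simp: Y_def Y'_def diff_eq_zero_mat_iff)
qed

lemma hermitian_involution_A1Q: "hermitian_involution A1Q"
proof -
  have "anticommuting (A1Q - mat_adjoint A1Q) A" if "i \<in> {2..k}" "A \<in> {AI i, AQ i}" for i A
  proof -
    have "A \<in> M" using that weight_carrier by auto
    then show ?thesis
      by (simp add: A1Q_carrier square_distribs intertwine_A1Q[OF that] uminus_diff_mat[of _ n n])
  qed
  then have "A1Q - mat_adjoint A1Q = 0\<^sub>m n n"
    using A1Q_carrier by (intro anticommuting_weights_eq_zero) auto
  then show ?thesis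
    using A1Q_carrier A1Q_unitary by (simp add: hermitian_involution_def diff_eq_zero_mat_iff)
qed

lemma commuting_A1Q:
  assumes "i \<in> {2..k}" "A \<in> {AI i, AQ i}"
  shows "commuting A A1Q"
  using intertwine_A1Q(1)[OF assms] hermitian_involutionD(2)[OF hermitian_involution_A1Q] by simp

lemma AI_mult_AQ_in_span:
  assumes i: "i \<in> {2..k}"
  obtains x y where "AI i * AQ i = x \<cdot>\<^sub>m I + y \<cdot>\<^sub>m A1Q"
proof -
  note weightM = skew_unitaryD(1)[OF skew_unitary_weights(1)]
    skew_unitaryD(1)[OF skew_unitary_weights(2)]
  define js where "js = remove1 i [2..<Suc k]"
  have js: "distinct js" "set js = {2..k} - {i}" "length js = 2 * (a - 1)"
    using i a rate by (auto simp: js_def length_remove1)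
  have "clifford (map AI js)" using js by (intro clifford_map_AI) auto
  moreover have "length (map AI js) = 2 * (a - 1)" using js by simp
  moreover have "A1Q \<noteq> I" "A1Q \<noteq> - I"
    using A1Q_not_real_multiple[of 1] A1Q_not_real_multiple[of "- 1"] by simp_all
  moreover have "\<forall>e\<in>set (map AI js). commuting A1Q e"
    using js(2) commuting_A1Q by auto
  moreover have "AI i * AQ i \<in> M" using weightM i by simp
  moreover have "commuting (AI i * AQ i) A" if A: "A \<in> set (map AI js)" for A
  proof -
    obtain j where j: "A = AI j" "j \<in> {2..k}" "j \<noteq> i" using A unfolding set_map js(2) by blast
    then have "commuting A (AI i * AQ i)"
      using i anticommuting_weights[OF j(2) i j(3)] weightM
      by (intro anticommuting_mult_right) simp_all
    then show ?thesis by simp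
  qed
  moreover have "commuting (AI i * AQ i) A1Q"
  proof -
    have "commuting A1Q (AI i * AQ i)"
      using i commuting_A1Q weightM hermitian_involutionD(1)[OF hermitian_involution_A1Q]
      by (intro commuting_mult_right) auto
    then show ?thesis by simp
  qed
  ultimately show thesis
    using commutant_clifford_involution[OF _ _ dim_eq_double hermitian_involution_A1Q] that by blast
qed

lemma AQ_eq_AI_mult_A1Q:
  assumes i: "i \<in> {2..k}"
  shows "AQ i = AI i * A1Q \<or> AQ i = - (AI i * A1Q)"
proof -
  note [simp] = skew_unitaryD[OF skew_unitary_weights(1)[OF i]]
    skew_unitaryD[OF skew_unitary_weights(2)[OF i]]
    hermitian_involutionD[OF hermitian_involution_A1Q]
  define X where "X = AI i * AQ i"
  have X [simp]: "X \<in> M" by (simp add: X_def)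
  obtain x y where xy: "X = x \<cdot>\<^sub>m I + y \<cdot>\<^sub>m A1Q"
    unfolding X_def by (rule AI_mult_AQ_in_span[OF i])
  have AQ: "AQ i = - (AI i * X)" by (simp add: X_def)
  have "A1Q * AI i = AI i * A1Q" using commuting_A1Q i by simp
  then have XA: "commuting X (AI i)" by (simp add: xy square_distribs)
  have "X * X = X * AI i * AQ i" by (simp add: X_def)
  also have "\<dots> = AI i * X * AQ i" unfolding XA ..
  also have "\<dots> = I" by (simp add: X_def)
  finally consider (one) "X = I" | (minus_one) "X = - I" | "X = A1Q" | "X = - A1Q"
    using involution_in_span[OF _ hermitian_involutionD(1,3)[OF hermitian_involution_A1Q] xy] dim
    by auto
  then show ?thesis
  proof cases
    case one
    then show ?thesis using AQ AQ_not_real_multiple[of i "- 1"] i by simp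
  next
    case minus_one
    then show ?thesis using AQ AQ_not_real_multiple[of i 1] i by simp
  qed (use AQ in simp_all)
qed

end

theorem theorem2:
  fixes a :: nat and AI AQ :: "nat \<Rightarrow> complex mat"
  assumes "a \<ge> 2"
    and "unitary_weight_SSD (2^a) (2*a) AI AQ"
    and "normalized_STBC (2^a) AI"
  shows "AQ 1 = mat_adjoint (AQ 1) \<and> AQ 1 * AQ 1 = 1\<^sub>m (2^a) \<and>
         (\<forall>i\<in>{2..2*a}. AI i * AQ 1 = AQ 1 * AI i \<and>
            (AQ i = AI i * AQ 1 \<or> AQ i = - (AI i * AQ 1)))"
proof -
  interpret maximal_rate_SSD "2^a" "2*a" AI AQ a
    using assms by unfold_locales auto
  show ?thesis
    using hermitian_involutionD(2,3)[OF hermitian_involution_A1Q] commuting_A1Q AQ_eq_AI_mult_A1Q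
    by (auto simp: A1Q_def)
qed

end
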